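(* The class of ULC measures is closed under convolution: if $\mu$ and $\nu$ are ULC probability measures on $\mathbb N^d$, then so is their convolution $\mu*\nu$.
   Context: $\mathbb N=\{0,1,2,\dots\}$, $[d]=\{1,\dots,d\}$, $\mathbf e_i$ is the $i$-th standard basis vector, $\mathbf n!=\prod_{i=1}^dn_i!$. Convolution: $(\mu*\nu)(\mathbf n)=\sum_{\mathbf 0\le\mathbf k\le\mathbf n}\mu(\mathbf k)\nu(\mathbf n-\mathbf k)$. ULC: a set $S\subseteq\mathbb N^d$ is downward closed if $\mathbf n\in S$ and $\mathbf 0\le\mathbf m\le\mathbf n$ (coordinatewise) imply $\mathbf m\in S$. A probability measure $\mu$ on $\mathbb N^d$ with downward closed support is ULC (ultra-log-concave) if, with $a(\mathbf n)=\mathbf n!\,\mu(\mathbf n)$ and $\mathcal I_{\mathbf n}=\{i\in[d]:\mathbf n+\mathbf e_i\in\mathrm{supp}(\mu)\}$, the matrix $\big(1-\frac{a(\mathbf n)a(\mathbf n+\mathbf e_i+\mathbf e_j)}{a(\mathbf n+\mathbf e_i)a(\mathbf n+\mathbf e_j)}\big)_{i,j\in\mathcal I_{\mathbf n}}$ is positive semidefinite for every $\mathbf n\in\mathrm{supp}(\mu)$. *)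

theory Defs
  imports "HOL-Probability.Probability"
begin

definition downward_closed :: "(nat ^ 'd) set \<Rightarrow> bool" where
  "downward_closed S \<longleftrightarrow> (\<forall>n\<in>S. \<forall>m\<le>n. m \<in> S)"

definition vec_fact :: "nat ^ 'd \<Rightarrow> nat" where
  "vec_fact n = (\<Prod>i\<in>UNIV. fact (n $ i))"

definition psd_on :: "'i set \<Rightarrow> ('i \<Rightarrow> 'i \<Rightarrow> real) \<Rightarrow> bool" where
  "psd_on I M \<longleftrightarrow>
     (\<forall>i\<in>I. \<forall>j\<in>I. M i j = M j i) \<and>
     (\<forall>x. 0 \<le> (\<Sum>i\<in>I. \<Sum>j\<in>I. x i * M i j * x j))"

definition weight :: "(nat ^ 'd) pmf \<Rightarrow> nat ^ 'd \<Rightarrow> real" where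
  "weight \<mu> n = real (vec_fact n) * pmf \<mu> n"

definition up_indices :: "(nat ^ 'd) pmf \<Rightarrow> nat ^ 'd \<Rightarrow> 'd set" where
  "up_indices \<mu> n = {i. n + axis i 1 \<in> set_pmf \<mu>}"

definition ULC :: "(nat ^ 'd) pmf \<Rightarrow> bool" where
  "ULC \<mu> \<longleftrightarrow> downward_closed (set_pmf \<mu>) \<and>
     (\<forall>n\<in>set_pmf \<mu>. psd_on (up_indices \<mu> n)
        (\<lambda>i j. 1 - weight \<mu> n * weight \<mu> (n + axis i 1 + axis j 1) /
                   (weight \<mu> (n + axis i 1) * weight \<mu> (n + axis j 1))))"

text \<open>
  Both \<^const>\<open>embed_pmf\<close> and a sum over an infinite set are total functions with default
  values; \<open>finite_atMost_vec\<close> and \<open>pmf_conv_pmf\<close> below show that neither default occurs here.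
\<close>

definition conv_pmf :: "(nat ^ 'd) pmf \<Rightarrow> (nat ^ 'd) pmf \<Rightarrow> (nat ^ 'd) pmf" where
  "conv_pmf \<mu> \<nu> = embed_pmf (\<lambda>n. \<Sum>k\<in>{0..n}. pmf \<mu> k * pmf \<nu> (n - k))"

lemma finite_atMost_vec: "finite {0..n :: nat ^ 'd}"
proof -
  have "{0..n} \<subseteq> vec_lambda ` (\<Pi>\<^sub>E i\<in>UNIV. {..n $ i})"
  proof
    fix k assume "k \<in> {0..n}"
    then have "vec_nth k \<in> (\<Pi>\<^sub>E i\<in>UNIV. {..n $ i})"
      by (auto simp: less_eq_vec_def)
    then show "k \<in> vec_lambda ` (\<Pi>\<^sub>E i\<in>UNIV. {..n $ i})"
      by (metis image_eqI vec_nth_inverse)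
  qed
  then show ?thesis
    by (rule finite_subset) (intro finite_imageI finite_PiE; simp)
qed

lemma pmf_map_add_pair_pmf:
  fixes \<mu> \<nu> :: "(nat ^ 'd) pmf"
  shows "pmf (map_pmf (\<lambda>(k, m). k + m) (pair_pmf \<mu> \<nu>)) n =
           (\<Sum>k\<in>{0..n}. pmf \<mu> k * pmf \<nu> (n - k))"
proof -
  have eq: "(\<lambda>(k, m). k + m) -` {n} = (\<lambda>k. (k, n - k)) ` {0..n}"
    by (auto simp: image_iff less_eq_vec_def vec_eq_iff)
  show ?thesis
    unfolding pmf_map eq
    by (subst measure_measure_pmf_finite)
       (auto simp: finite_atMost_vec sum.reindex inj_on_def pmf_pair)
qed

lemma conv_pmf_altdef:
  fixes \<mu> \<nu> :: "(nat ^ 'd) pmf"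
  shows "conv_pmf \<mu> \<nu> = map_pmf (\<lambda>(k, m). k + m) (pair_pmf \<mu> \<nu>)"
  unfolding conv_pmf_def pmf_map_add_pair_pmf[symmetric]
  by (rule type_definition.Rep_inverse[OF td_pmf_embed_pmf])

lemma pmf_conv_pmf:
  "pmf (conv_pmf \<mu> \<nu>) n = (\<Sum>k\<in>{0..n}. pmf \<mu> k * pmf \<nu> (n - k))"
  by (simp add: conv_pmf_altdef pmf_map_add_pair_pmf)

end

(*
  Writing a(n) = n! mu(n) for the derivatives at 0 of the generating function f of mu, the ULC
  condition says that log (D^n f) has a negative semidefinite Hessian at 0 for every n, i.e. that
  the homogenisation of f is Lorentzian.  A product f(x) g(y) in disjoint variables inherits the
  condition, and the convolution is the restriction of f(x) g(y) to x = y, whose derivatives at 0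
  are those of f(x) g(y) along the directions e_i + e'_i.  So it suffices that the condition is
  preserved by derivatives along nonnegative directions v.  Only third derivatives T enter there:
  each T_p has Lorentzian signature, and for A = sum_p v_p T_p the reversed Cauchy-Schwarz
  inequality for v gives x.Ax <= |Ax|^2 in a weighted inner product for which Av = v.  Hence no
  eigenvalue of A lies in (0,1), while by Perron-Frobenius 1 is the largest one and simple, so A
  has exactly one positive eigenvalue.
*)
theory Submission
  imports Defs
begin

section \<open>Quadratic forms with a single positive direction\<close>

text \<open>If some \<open>z\<close> orthogonal to \<open>w\<close> had \<open>B z z > 0\<close>,
  then \<open>B\<close> would be positive definite on the plane of \<open>w\<close> and
  \<open>z\<close>. This plane meets the hyperplane \<open>B u x = 0\<close>, on which
  \<open>B\<close> is nonpositive, in a nonzero vector. So \<open>B\<close> is nonpositive on the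
  complement of \<open>w\<close>, and splitting \<open>x\<close> along \<open>w\<close> gives the
  inequality.\<close>

lemma reversed_Cauchy_Schwarz_transfer:
  fixes B :: "'v::real_vector \<Rightarrow> 'v \<Rightarrow> real"
  assumes B: "bilinear B" and sym: "\<And>x y. B x y = B y x"
    and u: "B u u > 0" and rev: "\<And>x. B u x = 0 \<Longrightarrow> B x x \<le> 0"
    and w: "B w w > 0"
  shows "B w w * B x x \<le> (B w x)\<^sup>2"
proof -
  note bl = bilinear_ladd[OF B] bilinear_radd[OF B] bilinear_lmul[OF B] bilinear_rmul[OF B]
    bilinear_lsub[OF B] bilinear_rsub[OF B]
  have neg: "B z z \<le> 0" if z: "B w z = 0" for z
  proof (rule ccontr)
    assume "\<not> B z z \<le> 0"
    then have zz: "B z z > 0" by simp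
    \<comment> \<open>A vector of that plane killed by \<open>B u\<close>. If both of its
      coefficients vanish, \<open>z\<close> itself is killed by \<open>B u\<close>, which is the
      case left at the end.\<close>
    define t where "t = B u z *\<^sub>R w - B u w *\<^sub>R z"
    have "B u t = 0" by (simp add: t_def bl)
    then have "B t t \<le> 0" by (rule rev)
    moreover have "B t t = (B u z)\<^sup>2 * B w w + (B u w)\<^sup>2 * B z z"
      using z sym[of z w] by (simp add: t_def bl power2_eq_square algebra_simps)
    moreover have "0 \<le> (B u z)\<^sup>2 * B w w" "0 \<le> (B u w)\<^sup>2 * B z z" using zz w by auto
    ultimately have "(B u z)\<^sup>2 * B w w = 0" by linarith
    then have "B u z = 0" using w by simp
    then show False using rev zz by fastforce
  qed
  define c where "c = B w x / B w w"
  define z where "z = x - c *\<^sub>R w"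
  have cw: "c * B w w = B w x" using w by (simp add: c_def)
  have "B w z = 0" using cw by (simp add: z_def bl)
  then have "B z z \<le> 0" by (rule neg)
  moreover have "B z z = B x x - c * B w x"
    using cw sym[of x w] by (simp add: z_def bl algebra_simps)
  ultimately have "B x x \<le> c * B w x" by simp
  then have "B w w * B x x \<le> B w w * (c * B w x)" using w by simp
  also have "\<dots> = (B w x)\<^sup>2" using cw by (simp add: power2_eq_square algebra_simps)
  finally show ?thesis .
qed

text \<open>
  At a maximiser of the Rayleigh quotient on \<open>S\<close> the value is an eigenvalue \<open>M\<close>; the first
  inequality gives \<open>M \<le> M\<^sup>2\<close>, the second \<open>M < 1\<close>, so \<open>M \<le> 0\<close>.
\<close>
lemma eigenvalue_gap_imp_nonpos:
  fixes f :: "'v::euclidean_space \<Rightarrow> 'v"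
  assumes f: "linear f" and sym: "\<And>x y. f x \<bullet> y = x \<bullet> f y"
    and S: "subspace S" and inv: "\<And>x. x \<in> S \<Longrightarrow> f x \<in> S"
    and bochner: "\<And>x. x \<in> S \<Longrightarrow> x \<bullet> f x \<le> f x \<bullet> f x"
    and strict: "\<And>x. x \<in> S \<Longrightarrow> x \<noteq> 0 \<Longrightarrow> x \<bullet> f x < x \<bullet> x"
    and x: "x \<in> S"
  shows "x \<bullet> f x \<le> 0"
proof (cases "x = 0")
  case True
  then show ?thesis by simp
next
  case False
  let ?K = "S \<inter> sphere 0 1"
  have lin: "f (a + b) = f a + f b" "f (r *\<^sub>R a) = r *\<^sub>R f a" for a b r
    using f by (auto simp: linear_add linear_scale)
  have "compact ?K" using S closed_subspace compact_sphere by (metis closed_Int_compact)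
  moreover have "(1 / norm x) *\<^sub>R x \<in> ?K"
    using x False S by (auto simp: subspace_scale)
  then have "?K \<noteq> {}" by blast
  moreover have "continuous_on ?K (\<lambda>x. x \<bullet> f x)"
    using f by (intro continuous_intros linear_continuous_on) (simp add: linear_conv_bounded_linear)
  ultimately obtain e where e: "e \<in> ?K" and max: "\<And>y. y \<in> ?K \<Longrightarrow> y \<bullet> f y \<le> e \<bullet> f e"
    using continuous_attains_sup[of ?K "\<lambda>x. x \<bullet> f x"] by blast
  define M where "M = e \<bullet> f e"
  have eS: "e \<in> S" and ee: "e \<bullet> e = 1" using e by (auto simp: norm_eq_1)
  have bound: "y \<bullet> f y \<le> M * (y \<bullet> y)" if y: "y \<in> S" for y
  proof (cases "y = 0")
    case False
    then have "(1 / norm y) *\<^sub>R y \<in> ?K" using y S by (auto simp: subspace_scale)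
    from max[OF this] have "(y \<bullet> f y) / (norm y)\<^sup>2 \<le> M"
      by (simp add: M_def lin power2_eq_square)
    then show ?thesis using False by (simp add: divide_simps power2_norm_eq_inner)
  qed simp
  \<comment> \<open>Half the gradient at \<open>e\<close> of the defect
    \<open>M * (y \<bullet> y) - y \<bullet> f y\<close>, which is nonnegative on \<open>S\<close>
    and zero at \<open>e\<close>.\<close>
  define z where "z = M *\<^sub>R e - f e"
  have zS: "z \<in> S" unfolding z_def using S eS inv by (simp add: subspace_diff subspace_scale)
  define g where "g = M * (z \<bullet> z) - z \<bullet> f z"
  have "z \<bullet> z = 0"
  proof (rule ccontr)
    assume "z \<bullet> z \<noteq> 0"
    then have zz: "z \<bullet> z > 0" by (simp add: less_le)
    have g0: "g \<ge> 0" using bound[OF zS] by (simp add: g_def)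
    \<comment> \<open>A step against the gradient, short enough that the second-order term
      \<open>t\<^sup>2 * g\<close> cannot outweigh the linear one; the defect would become
      negative.\<close>
    define t where "t = - ((z \<bullet> z) / (g + 1))"
    have "e + t *\<^sub>R z \<in> S" using S eS zS by (simp add: subspace_add subspace_scale)
    from bound[OF this] have "0 \<le> 2 * t * (z \<bullet> (M *\<^sub>R e - f e)) + t\<^sup>2 * g"
      using sym[of z e] sym[of e z] ee
      by (simp add: lin inner_simps g_def power2_eq_square M_def inner_commute algebra_simps)
    then have "0 \<le> t * (2 * (z \<bullet> z) + t * g)"
      by (simp add: z_def[symmetric] power2_eq_square algebra_simps)
    moreover have "t < 0" using zz g0 by (simp add: t_def)
    moreover have "t * g \<ge> - (z \<bullet> z)"
      using zz g0 by (simp add: t_def field_simps)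
    then have "2 * (z \<bullet> z) + t * g > 0" using zz by linarith
    ultimately show False by (simp add: zero_le_mult_iff)
  qed
  then have fe: "f e = M *\<^sub>R e" by (simp add: z_def)
  have "M \<le> M * M" using bochner[OF eS] ee by (simp add: fe)
  moreover have "M < 1" using strict[OF eS] ee unfolding M_def by fastforce
  ultimately have "M \<le> 0" by (metis mult_le_cancel_left1 mult.commute not_le)
  then have "M * (x \<bullet> x) \<le> 0" by (simp add: mult_nonpos_nonneg)
  then show ?thesis using bound[OF x] by simp
qed

text \<open>In the inner product with weights \<open>w\<close>, the operator
  \<open>w\<close>-inverse times \<open>A\<close> is selfadjoint and fixes \<open>u\<close>. The
  hypothesis \<open>bochner\<close> excludes eigenvalues strictly between 0 and 1, and
  Perron-Frobenius makes 1 a simple top eigenvalue, so the form is nonpositive on the complement of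
  \<open>u\<close>. Connectedness of \<open>A\<close> on the support of \<open>u\<close> comes from
  \<open>conn\<close>: the index \<open>y\<close> is adjacent to all of it.\<close>

lemma bochner_Perron_imp_nonpos:
  fixes A :: "'k::finite \<Rightarrow> 'k \<Rightarrow> real"
  assumes sym: "\<And>p q. A p q = A q p" and nonneg: "\<And>p q. A p q \<ge> 0"
    and w: "\<And>p. w p > 0" and u: "\<And>p. u p \<ge> 0"
    and eig: "\<And>p. (\<Sum>q\<in>UNIV. A p q * u q) = w p * u p"
    and off: "\<And>p q. u p = 0 \<Longrightarrow> A p q = 0"
    and conn: "\<And>p. u p > 0 \<Longrightarrow> A y p > 0" and uy: "u y > 0"
    and bochner: "\<And>x. (\<Sum>p\<in>UNIV. x p * (\<Sum>q\<in>UNIV. A p q * x q))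
                    \<le> (\<Sum>p\<in>UNIV. (\<Sum>q\<in>UNIV. A p q * x q)\<^sup>2 / w p)"
    and x: "(\<Sum>p\<in>UNIV. w p * u p * x p) = 0"
  shows "(\<Sum>p\<in>UNIV. x p * (\<Sum>q\<in>UNIV. A p q * x q)) \<le> 0"
proof -
  \<comment> \<open>Rescaling coordinates by \<open>s\<close> turns the weighted inner product into
    the standard one.\<close>
  define s where "s p = sqrt (w p)" for p
  have s: "s p > 0" "s p * s p = w p" for p using w[of p] by (auto simp: s_def less_imp_le)
  have s0: "s p \<noteq> 0" for p using s(1)[of p] by simp
  define f :: "real^'k \<Rightarrow> real^'k"
    where "f X = (\<chi> p. (\<Sum>q\<in>UNIV. A p q * (X $ q / s q)) / s p)" for X
  define U :: "real^'k" where "U = (\<chi> p. s p * u p)"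
  have lin: "linear f"
    by (rule linearI)
      (simp_all add: f_def vec_eq_iff sum.distrib[symmetric] sum_distrib_left add_divide_distrib[symmetric]
         algebra_simps sum_divide_distrib)
  have selfadj: "f X \<bullet> Y = X \<bullet> f Y" for X Y
  proof -
    have "f X \<bullet> Y = (\<Sum>p\<in>UNIV. \<Sum>q\<in>UNIV. A p q * (X $ q / s q) * (Y $ p / s p))"
      by (simp add: f_def inner_vec_def sum_distrib_right sum_divide_distrib)
    also have "\<dots> = (\<Sum>q\<in>UNIV. \<Sum>p\<in>UNIV. A p q * (X $ q / s q) * (Y $ p / s p))"
      by (rule sum.swap)
    also have "\<dots> = X \<bullet> f Y"
      by (simp add: f_def inner_vec_def sum_distrib_left sum_divide_distrib sym mult_ac)
    finally show ?thesis .
  qed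
  have fU: "f U = U"
    using s0 s(2)[symmetric] by (simp add: f_def U_def vec_eq_iff eig)
  define S where "S = {X. U \<bullet> X = 0}"
  have quad: "X \<bullet> f X = (\<Sum>p\<in>UNIV. (X $ p / s p) * (\<Sum>q\<in>UNIV. A p q * (X $ q / s q)))" for X
    by (simp add: f_def inner_vec_def)
  \<comment> \<open>With \<open>r\<close> the ratio of \<open>z\<close> to \<open>u\<close>, the
    difference of \<open>X \<bullet> X\<close> and \<open>X \<bullet> f X\<close> is half of the sum
    of \<open>A p q * u p * u q * (r p - r q)\<^sup>2\<close> plus the mass
    \<open>w p * (z p)\<^sup>2\<close> where \<open>u p = 0\<close>. If it is not positive, both
    parts vanish.\<close>
  have strict: "X \<bullet> f X < X \<bullet> X" if XS: "X \<in> S" and X0: "X \<noteq> 0" for X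
  proof (rule ccontr)
    assume contra: "\<not> X \<bullet> f X < X \<bullet> X"
    define z where "z p = X $ p / s p" for p
    define r where "r p = z p / u p" for p
    \<comment> \<open>Division by zero gives \<open>r p = 0\<close> where \<open>u p = 0\<close>.
      There \<open>off\<close> removes the row and column of \<open>A\<close>, so replacing
      \<open>z\<close> by \<open>u * r\<close> leaves the quadratic form unchanged.\<close>
    have rz: "u p * r p = (if u p = 0 then 0 else z p)" for p by (simp add: r_def)
    have "(\<Sum>p\<in>UNIV. \<Sum>q\<in>UNIV. A p q * u p * u q * (r p - r q)\<^sup>2)
        = (\<Sum>p\<in>UNIV. \<Sum>q\<in>UNIV. A p q * u q * (u p * (r p)\<^sup>2))
        + (\<Sum>p\<in>UNIV. \<Sum>q\<in>UNIV. A p q * u p * (u q * (r q)\<^sup>2))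
        - 2 * (\<Sum>p\<in>UNIV. \<Sum>q\<in>UNIV. A p q * (u p * r p) * (u q * r q))"
      by (simp add: sum.distrib[symmetric] sum_subtractf[symmetric] sum_distrib_left
          power2_eq_square algebra_simps)
    also have "(\<Sum>p\<in>UNIV. \<Sum>q\<in>UNIV. A p q * u p * (u q * (r q)\<^sup>2))
        = (\<Sum>p\<in>UNIV. \<Sum>q\<in>UNIV. A p q * u q * (u p * (r p)\<^sup>2))"
      by (subst sum.swap) (simp add: sym)
    also have "(\<Sum>p\<in>UNIV. \<Sum>q\<in>UNIV. A p q * u q * (u p * (r p)\<^sup>2))
        = (\<Sum>p\<in>UNIV. w p * (u p * r p)\<^sup>2)"
      unfolding sum_distrib_right[symmetric] eig by (simp add: power2_eq_square mult_ac)
    also have "(\<Sum>p\<in>UNIV. \<Sum>q\<in>UNIV. A p q * (u p * r p) * (u q * r q)) = X \<bullet> f X"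
      unfolding quad z_def[symmetric] sum_distrib_left
    proof (intro sum.cong refl)
      fix p q
      show "A p q * (u p * r p) * (u q * r q) = z p * (A p q * z q)"
        using off[of p q] off[of q p] sym[of p q] by (auto simp: rz)
    qed
    finally have sos: "(\<Sum>p\<in>UNIV. \<Sum>q\<in>UNIV. A p q * u p * u q * (r p - r q)\<^sup>2)
        = 2 * ((\<Sum>p\<in>UNIV. w p * (u p * r p)\<^sup>2) - X \<bullet> f X)" by simp
    have XX: "X \<bullet> X = (\<Sum>p\<in>UNIV. w p * (z p)\<^sup>2)"
      using s0 s(2)[symmetric] by (simp add: inner_vec_def z_def power2_eq_square)
    have nn: "0 \<le> A p q * u p * u q * (r p - r q)\<^sup>2" for p q using nonneg u by simp
    have sos0: "0 \<le> (\<Sum>p\<in>UNIV. \<Sum>q\<in>UNIV. A p q * u p * u q * (r p - r q)\<^sup>2)"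
      by (intro sum_nonneg nn)
    have D: "0 \<le> w p * (z p)\<^sup>2 - w p * (u p * r p)\<^sup>2" for p
      using w[of p] by (simp add: rz)
    have Ds: "(\<Sum>p\<in>UNIV. w p * (z p)\<^sup>2 - w p * (u p * r p)\<^sup>2) \<le> 0"
      using sos sos0 contra XX by (simp add: sum_subtractf)
    have "(\<Sum>p\<in>UNIV. w p * (z p)\<^sup>2 - w p * (u p * r p)\<^sup>2) = 0"
      using Ds sum_nonneg[of UNIV "\<lambda>p. w p * (z p)\<^sup>2 - w p * (u p * r p)\<^sup>2"] D by simp
    then have zero: "w p * (z p)\<^sup>2 - w p * (u p * r p)\<^sup>2 = 0" for p
      using D by (subst (asm) sum_nonneg_eq_0_iff) auto
    then have z0: "z p = u p * r p" for p
      using w[of p] zero[of p] by (auto simp: rz split: if_splits)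
    have "(\<Sum>p\<in>UNIV. \<Sum>q\<in>UNIV. A p q * u p * u q * (r p - r q)\<^sup>2) = 0"
      using sos sos0 contra XX z0 by simp
    \<comment> \<open>The row of \<open>y\<close> reaches the whole support of \<open>u\<close>, so
      \<open>r\<close> is constant there and \<open>X\<close> is a multiple of \<open>U\<close>, to
      which it is orthogonal.\<close>
    then have "A y q * u y * u q * (r y - r q)\<^sup>2 = 0" for q
      by (simp add: sum_nonneg_eq_0_iff sum_nonneg nn)
    then have "A y q = 0 \<or> u q = 0 \<or> r q = r y" for q
      using uy by (metis mult_eq_0_iff order_less_irrefl power_eq_0_iff right_minus_eq)
    then have "u q = 0 \<or> r q = r y" for q
      using conn[of q] u[of q] by (metis order_less_irrefl order_le_less)
    then have zc: "z p = u p * r y" for p using z0[of p] by auto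
    have "U \<bullet> X = (\<Sum>p\<in>UNIV. w p * u p * z p)"
      using s0 s(2)[symmetric] by (simp add: U_def inner_vec_def z_def mult_ac)
    also have "\<dots> = r y * (\<Sum>p\<in>UNIV. w p * (u p)\<^sup>2)"
      by (simp add: zc power2_eq_square sum_distrib_left mult_ac)
    finally have "r y * (\<Sum>p\<in>UNIV. w p * (u p)\<^sup>2) = 0" using XS by (simp add: S_def)
    moreover have "(\<Sum>p\<in>UNIV. w p * (u p)\<^sup>2) > 0"
      using uy w by (intro sum_pos2[of _ y]) (auto simp: less_imp_le)
    ultimately have "r y = 0" by simp
    then have "X = 0" using zc s0 by (simp add: z_def vec_eq_iff)
    then show False using X0 by simp
  qed
  define X :: "real^'k" where "X = (\<chi> p. s p * x p)"
  have Xs: "X $ p / s p = x p" for p using s0 by (simp add: X_def)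
  have "X \<bullet> f X \<le> 0"
  proof (rule eigenvalue_gap_imp_nonpos[of f S])
    show "subspace S" by (simp add: S_def subspace_hyperplane)
    show "f Y \<in> S" if "Y \<in> S" for Y using that fU selfadj[of U Y] by (simp add: S_def)
    show "Y \<bullet> f Y \<le> f Y \<bullet> f Y" for Y
      using bochner[of "\<lambda>p. Y $ p / s p"] s(2)
      by (simp add: quad) (simp add: f_def inner_vec_def power2_eq_square)
    show "X \<in> S"
      using x s(2)[symmetric] by (simp add: S_def U_def X_def inner_vec_def mult_ac)
  qed (use lin selfadj strict in auto)
  then show ?thesis unfolding quad Xs .
qed


section \<open>Derivatives of cubic forms along nonnegative directions\<close>

text \<open>Each slice \<open>T p\<close> satisfies a reversed Cauchy-Schwarz inequality at the
  basis vector of \<open>y\<close>. Moved to the direction \<open>u\<close> and summed over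
  \<open>p\<close>, these inequalities give the hypothesis \<open>bochner\<close> of the Perron
  argument for \<open>A\<close>, since pairing with \<open>u\<close> in slice \<open>p\<close> is
  the \<open>p\<close>-th entry of \<open>A x\<close>.\<close>

lemma Lorentzian_cubic_derivative_pos:
  fixes T :: "'k::finite \<Rightarrow> 'k \<Rightarrow> 'k \<Rightarrow> real"
  assumes swap12: "\<And>p q r. T p q r = T q p r" and swap23: "\<And>p q r. T p q r = T p r q"
    and nonneg: "\<And>p q r. T p q r \<ge> 0"
    and lor: "\<And>p x. T p y y * (\<Sum>q\<in>UNIV. \<Sum>r\<in>UNIV. x q * x r * T p q r)
                 \<le> (\<Sum>q\<in>UNIV. x q * T p y q)\<^sup>2"
    and yyy: "T y y y > 0" and supp: "\<And>p q r. T p y y = 0 \<Longrightarrow> T p q r = 0"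
    and v: "\<And>p. v p > 0"
  defines "A \<equiv> \<lambda>q r. \<Sum>p\<in>UNIV. v p * T p q r"
  shows "A y y * (\<Sum>q\<in>UNIV. \<Sum>r\<in>UNIV. x q * x r * A q r) \<le> (\<Sum>q\<in>UNIV. x q * A y q)\<^sup>2"
proof -
  \<comment> \<open>Where \<open>T p y y = 0\<close> the whole slice vanishes, so zeroing
    \<open>v\<close> there does not change \<open>A\<close>; every index with \<open>u p > 0\<close>
    then has a slice positive at \<open>y\<close>.\<close>
  define u where "u p = (if T p y y = 0 then 0 else v p)" for p
  have u0: "u p \<ge> 0" for p using v[of p] by (simp add: u_def)
  have uT: "u p * T p q r = v p * T p q r" for p q r using supp by (simp add: u_def)
  have A: "A q r = (\<Sum>p\<in>UNIV. u p * T p q r)" for q r by (simp add: A_def uT)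
  have T_off: "T p q r = 0" if "u p = 0" for p q r
    using that v[of p] supp by (auto simp: u_def split: if_splits)
  have T_on: "T p y y > 0" if "u p > 0" for p
    using that nonneg[of p y y] by (auto simp: u_def less_le split: if_splits)
  have uy: "u y > 0" using yyy v by (simp add: u_def)
  have Asym: "A q r = A r q" for q r by (simp add: A_def swap23)
  have Ann: "A q r \<ge> 0" for q r by (simp add: A sum_nonneg nonneg u0)
  have Aoff: "A p q = 0" if "u p = 0" for p q
    using T_off[OF that] swap12 by (simp add: A)
  define F where "F p X Z = (\<Sum>q\<in>UNIV. \<Sum>r\<in>UNIV. (X $ q) * (Z $ r) * T p q r)"
    for p and X Z :: "real^'k"
  have biF: "bilinear (F p)" for p
    unfolding bilinear_def
    by (auto intro!: linearI simp: F_def sum.distrib[symmetric] sum_distrib_left algebra_simps)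
  have symF: "F p X Z = F p Z X" for p X Z
    unfolding F_def by (subst sum.swap) (simp add: swap23 mult_ac)
  have AF: "(\<Sum>q\<in>UNIV. A p q * (X $ q)) = F p (\<chi> q. u q) X" for p X
    unfolding F_def A sum_distrib_right
    by (subst sum.swap) (simp add: swap12 mult_ac)
  have axF: "F p (axis y 1) X = (\<Sum>q\<in>UNIV. X $ q * T p y q)" for p X
  proof -
    have "F p (axis y 1) X = (\<Sum>q\<in>UNIV. if q = y then (\<Sum>r\<in>UNIV. X $ r * T p q r) else 0)"
      unfolding F_def by (intro sum.cong) (auto simp: axis_def)
    then show ?thesis by simp
  qed
  have axF2: "F p (axis y 1) (axis y 1) = T p y y" for p
  proof -
    have "F p (axis y 1) (axis y 1) = (\<Sum>q\<in>UNIV. if q = y then T p y q else 0)"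
      unfolding axF by (intro sum.cong) (auto simp: axis_def)
    then show ?thesis by simp
  qed
  have Fu: "F p (\<chi> q. u q) (\<chi> q. u q) > 0" if "u p > 0" for p
  proof -
    have "0 < u y * u y * T p y y" using uy T_on[OF that] by simp
    also have "\<dots> \<le> (\<Sum>r\<in>UNIV. u y * u r * T p y r)"
      by (rule member_le_sum[of y UNIV "\<lambda>r. u y * u r * T p y r"]) (auto simp: u0 nonneg)
    also have "\<dots> \<le> (\<Sum>q\<in>UNIV. \<Sum>r\<in>UNIV. u q * u r * T p q r)"
      by (rule member_le_sum[of y UNIV "\<lambda>q. \<Sum>r\<in>UNIV. u q * u r * T p q r"])
         (auto simp: u0 nonneg sum_nonneg)
    finally show ?thesis by (simp add: F_def)
  qed
  have rev: "F p (\<chi> q. u q) (\<chi> q. u q) * F p X X \<le> (F p (\<chi> q. u q) X)\<^sup>2" if "u p > 0" for p X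
  proof (rule reversed_Cauchy_Schwarz_transfer[OF biF symF, of p "axis y 1"])
    show "0 < F p (axis y 1) (axis y 1)" using T_on[OF that] by (simp add: axF2)
    fix Z assume "F p (axis y 1) Z = 0"
    then have "T p y y * F p Z Z \<le> 0"
      using lor[of p "\<lambda>q. Z $ q"] by (simp add: axF) (simp add: F_def)
    then show "F p Z Z \<le> 0" using T_on[OF that] by (simp add: mult_le_0_iff)
  qed (rule Fu[OF that])
  \<comment> \<open>Chosen so that \<open>A u = w u\<close>. Where \<open>u p = 0\<close> the row of
    \<open>A\<close> vanishes and any positive value serves.\<close>
  define w where "w p = (if u p = 0 then 1 else F p (\<chi> q. u q) (\<chi> q. u q) / u p)" for p
  have w: "w p > 0" for p using u0[of p] Fu[of p] by (auto simp: w_def less_le)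
  have eig: "(\<Sum>q\<in>UNIV. A p q * u q) = w p * u p" for p
    using AF[of p "\<chi> q. u q"] Aoff[of p] by (auto simp: w_def)
  have conn: "A y p > 0" if "u p > 0" for p
  proof -
    have "0 < u y * T y y p" using uy T_on[OF that] swap12 swap23
      by simp
    also have "\<dots> \<le> A y p" unfolding A
      by (rule member_le_sum[of y UNIV "\<lambda>q. u q * T q y p"]) (auto simp: u0 nonneg)
    finally show ?thesis .
  qed
  define G where "G X Z = (\<Sum>p\<in>UNIV. u p * F p X Z)" for X Z
  have G_eq: "G X Z = (\<Sum>q\<in>UNIV. X $ q * (\<Sum>r\<in>UNIV. A q r * Z $ r))" for X Z
  proof -
    have "G X Z = (\<Sum>p\<in>UNIV. \<Sum>q\<in>UNIV. \<Sum>r\<in>UNIV. u p * (X $ q * Z $ r * T p q r))"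
      by (simp add: G_def F_def sum_distrib_left)
    also have "\<dots> = (\<Sum>q\<in>UNIV. \<Sum>p\<in>UNIV. \<Sum>r\<in>UNIV. u p * (X $ q * Z $ r * T p q r))"
      by (rule sum.swap)
    also have "\<dots> = (\<Sum>q\<in>UNIV. \<Sum>r\<in>UNIV. \<Sum>p\<in>UNIV. u p * (X $ q * Z $ r * T p q r))"
      by (intro sum.cong refl sum.swap)
    also have "\<dots> = (\<Sum>q\<in>UNIV. X $ q * (\<Sum>r\<in>UNIV. A q r * Z $ r))"
      by (simp add: A sum_distrib_left sum_distrib_right mult_ac)
    finally show ?thesis .
  qed
  have biG: "bilinear G"
    unfolding bilinear_def G_def
    by (auto intro!: linearI simp: sum.distrib[symmetric] sum_distrib_left algebra_simps
        bilinear_ladd[OF biF] bilinear_radd[OF biF] bilinear_lmul[OF biF] bilinear_rmul[OF biF])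
  have symG: "G X Z = G Z X" for X Z unfolding G_def by (simp add: symF)
  \<comment> \<open>Termwise, this is \<open>rev\<close> multiplied by \<open>u p\<close> and
    divided by the value of \<open>F p\<close> at \<open>u\<close>.\<close>
  have bochner: "G X X \<le> (\<Sum>p\<in>UNIV. (\<Sum>q\<in>UNIV. A p q * X $ q)\<^sup>2 / w p)" for X
    unfolding G_def
  proof (rule sum_mono)
    fix p
    show "u p * F p X X \<le> (\<Sum>q\<in>UNIV. A p q * X $ q)\<^sup>2 / w p"
    proof (cases "u p = 0")
      case False
      then have up: "u p > 0" using u0[of p] by simp
      then show ?thesis
        using rev[OF up, of X] Fu[OF up] by (simp add: AF w_def field_simps)
    qed (simp add: w_def)
  qed
  \<comment> \<open>The Perron argument controls the complement of \<open>u\<close>; the claim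
    concerns the basis vector of \<open>y\<close>, hence a second transfer.\<close>
  have "G (axis y 1) (axis y 1) * G X X \<le> (G (axis y 1) X)\<^sup>2" for X
  proof (rule reversed_Cauchy_Schwarz_transfer[OF biG symG, of "\<chi> q. u q"])
    show "0 < G (\<chi> q. u q) (\<chi> q. u q)" unfolding G_def
    proof (intro sum_pos2[of _ y])
      show "0 < u y * F y (\<chi> q. u q) (\<chi> q. u q)" using uy Fu by simp
      show "0 \<le> u p * F p (\<chi> q. u q) (\<chi> q. u q)" for p
        using u0[of p] Fu[of p] by (cases "u p = 0") (auto simp: less_imp_le)
    qed auto
    show "0 < G (axis y 1) (axis y 1)" unfolding G_def axF2
      using uy yyy u0 nonneg by (intro sum_pos2[of _ y]) auto
    fix Z assume Z: "G (\<chi> q. u q) Z = 0"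
    \<comment> \<open>As \<open>A u = w u\<close>, orthogonality to \<open>u\<close> for
      \<open>G\<close> is orthogonality in the \<open>w\<close>-weighted inner product.\<close>
    have "G Z (\<chi> q. u q) = (\<Sum>p\<in>UNIV. w p * u p * Z $ p)"
      by (simp add: G_eq eig) (simp add: mult_ac)
    then have Z0: "(\<Sum>p\<in>UNIV. w p * u p * Z $ p) = 0" using Z symG by simp
    show "G Z Z \<le> 0" unfolding G_eq
    proof (rule bochner_Perron_imp_nonpos[of A w u y])
      show "(\<Sum>p\<in>UNIV. x p * (\<Sum>q\<in>UNIV. A p q * x q))
              \<le> (\<Sum>p\<in>UNIV. (\<Sum>q\<in>UNIV. A p q * x q)\<^sup>2 / w p)" for x
        using bochner[of "\<chi> p. x p"] by (simp add: G_eq)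
    qed (use Asym Ann w u0 eig Aoff conn uy Z0 in auto)
  qed
  note main = this[of "\<chi> p. x p"]
  have "G (axis y 1) (axis y 1) = A y y" by (simp add: G_def axF2 A)
  moreover have "G (axis y 1) (\<chi> p. x p) = (\<Sum>q\<in>UNIV. x q * A y q)"
  proof -
    have "G (axis y 1) (\<chi> p. x p) = (\<Sum>q\<in>UNIV. if q = y then (\<Sum>r\<in>UNIV. A q r * x r) else 0)"
      unfolding G_eq by (intro sum.cong) (auto simp: axis_def)
    then show ?thesis by (simp add: mult.commute)
  qed
  moreover have "G (\<chi> p. x p) (\<chi> p. x p) = (\<Sum>q\<in>UNIV. \<Sum>r\<in>UNIV. x q * x r * A q r)"
    by (simp add: G_eq sum_distrib_left mult_ac)
  ultimately show ?thesis using main by simp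
qed


text \<open>Perturbing \<open>v\<close> to \<open>v + \<epsilon>\<close> gives strictly positive
  directions, and both sides are continuous in \<epsilon>.\<close>

lemma Lorentzian_cubic_derivative:
  fixes T :: "'k::finite \<Rightarrow> 'k \<Rightarrow> 'k \<Rightarrow> real"
  assumes swap12: "\<And>p q r. T p q r = T q p r" and swap23: "\<And>p q r. T p q r = T p r q"
    and nonneg: "\<And>p q r. T p q r \<ge> 0"
    and lor: "\<And>p x. T p y y * (\<Sum>q\<in>UNIV. \<Sum>r\<in>UNIV. x q * x r * T p q r)
                 \<le> (\<Sum>q\<in>UNIV. x q * T p y q)\<^sup>2"
    and yyy: "T y y y > 0" and supp: "\<And>p q r. T p y y = 0 \<Longrightarrow> T p q r = 0"
    and v: "\<And>p. v p \<ge> 0"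
  shows "(\<Sum>p\<in>UNIV. v p * T p y y) * (\<Sum>q\<in>UNIV. \<Sum>r\<in>UNIV. x q * x r * (\<Sum>p\<in>UNIV. v p * T p q r))
           \<le> (\<Sum>q\<in>UNIV. x q * (\<Sum>p\<in>UNIV. v p * T p y q))\<^sup>2"
proof -
  define L where "L \<epsilon> = (\<Sum>p\<in>UNIV. (v p + \<epsilon>) * T p y y) *
      (\<Sum>q\<in>UNIV. \<Sum>r\<in>UNIV. x q * x r * (\<Sum>p\<in>UNIV. (v p + \<epsilon>) * T p q r))" for \<epsilon>
  define R where "R \<epsilon> = (\<Sum>q\<in>UNIV. x q * (\<Sum>p\<in>UNIV. (v p + \<epsilon>) * T p y q))\<^sup>2" for \<epsilon>
  have "L (inverse (real (Suc n))) \<le> R (inverse (real (Suc n)))" for n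
    unfolding L_def R_def
  proof (rule Lorentzian_cubic_derivative_pos[OF swap12 swap23 nonneg lor yyy supp])
    show "v p + inverse (real (Suc n)) > 0" for p
      using v[of p] by (intro add_nonneg_pos) auto
  qed
  moreover have "(\<lambda>n. L (inverse (real (Suc n)))) \<longlonglongrightarrow> L 0"
    unfolding L_def by (intro tendsto_intros LIMSEQ_inverse_real_of_nat)
  moreover have "(\<lambda>n. R (inverse (real (Suc n)))) \<longlonglongrightarrow> R 0"
    unfolding R_def by (intro tendsto_intros LIMSEQ_inverse_real_of_nat)
  ultimately have "L 0 \<le> R 0" by (intro LIMSEQ_le) auto
  then show ?thesis by (simp add: L_def R_def)
qed

section \<open>Ultra-log-concave coefficient families and their closure properties\<close>

text \<open>
  With \<open>c n\<close> the \<open>n\<close>-th derivative at \<open>0\<close> of a power series, the inequality says that the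
  Hessian at \<open>0\<close> of the logarithm of every derivative is negative semidefinite.
\<close>
definition ulc_wrt :: "('i::finite \<Rightarrow> 'm::comm_monoid_add) \<Rightarrow> ('m \<Rightarrow> real) \<Rightarrow> bool" where
  "ulc_wrt e c \<longleftrightarrow> (\<forall>n. c n \<ge> 0) \<and> (\<forall>n i. c n = 0 \<longrightarrow> c (n + e i) = 0) \<and>
     (\<forall>n x. c n * (\<Sum>i\<in>UNIV. \<Sum>j\<in>UNIV. x i * x j * c (n + e i + e j))
              \<le> (\<Sum>i\<in>UNIV. x i * c (n + e i))\<^sup>2)"

lemma ulc_wrtD:
  assumes "ulc_wrt e c"
  shows "c n \<ge> 0" and "c n = 0 \<Longrightarrow> c (n + e i) = 0"
    and "c n * (\<Sum>i\<in>UNIV. \<Sum>j\<in>UNIV. x i * x j * c (n + e i + e j))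
           \<le> (\<Sum>i\<in>UNIV. x i * c (n + e i))\<^sup>2"
  using assms unfolding ulc_wrt_def by blast+

lemma sum_UNIV_option:
  fixes f :: "'i::finite option \<Rightarrow> 'b::comm_monoid_add"
  shows "(\<Sum>p\<in>UNIV. f p) = f None + (\<Sum>i\<in>UNIV. f (Some i))"
  by (simp add: UNIV_option_conv sum.reindex)

text \<open>The index \<open>None\<close> is the homogenising variable: its generator is \<open>0\<close>.\<close>
lemma ulc_wrt_homogenize:
  fixes e :: "'i::finite \<Rightarrow> 'm::comm_monoid_add"
  assumes "ulc_wrt e c"
  shows "ulc_wrt (case_option 0 e) c"
  unfolding ulc_wrt_def
proof (intro conjI allI impI)
  let ?E = "case_option 0 e"
  show "c n \<ge> 0" for n by (rule ulc_wrtD[OF assms])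
  show "c (n + ?E p) = 0" if "c n = 0" for n p
    using ulc_wrtD(2)[OF assms that] that by (cases p) auto
  fix n and x :: "'i option \<Rightarrow> real"
  define s where "s = x None"
  define l where "l = (\<Sum>i\<in>UNIV. x (Some i) * c (n + e i))"
  define Q where "Q = (\<Sum>i\<in>UNIV. \<Sum>j\<in>UNIV. x (Some i) * x (Some j) * c (n + e i + e j))"
  have "(\<Sum>p\<in>UNIV. \<Sum>q\<in>UNIV. x p * x q * c (n + ?E p + ?E q)) = s * s * c n + 2 * s * l + Q"
    by (simp add: sum_UNIV_option s_def l_def Q_def sum.distrib sum_distrib_left mult_ac)
  moreover have "(\<Sum>p\<in>UNIV. x p * c (n + ?E p)) = s * c n + l"
    by (simp add: sum_UNIV_option s_def l_def)
  moreover have "c n * Q \<le> l\<^sup>2" unfolding Q_def l_def by (rule ulc_wrtD[OF assms])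
  \<comment> \<open>The terms in \<open>s\<close> agree on both sides, which leaves
    \<open>c n * Q \<le> l\<^sup>2\<close>.\<close>
  ultimately show "c n * (\<Sum>p\<in>UNIV. \<Sum>q\<in>UNIV. x p * x q * c (n + ?E p + ?E q))
      \<le> (\<Sum>p\<in>UNIV. x p * c (n + ?E p))\<^sup>2"
    by (simp add: power2_eq_square algebra_simps)
qed

text \<open>After homogenisation the coefficients of order at most three beyond \<open>n\<close>
  form one symmetric cubic tensor \<open>T\<close>. The condition at \<open>n + E p\<close> is the
  reversed Cauchy-Schwarz inequality of its slice \<open>p\<close> at \<open>None\<close>.\<close>

lemma ulc_wrt_directional_derivative:
  fixes e :: "'i::finite \<Rightarrow> 'm::comm_monoid_add"
  assumes c: "ulc_wrt e c" and v: "\<And>i. v i \<ge> 0"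
  shows "ulc_wrt e (\<lambda>n. \<Sum>i\<in>UNIV. v i * c (n + e i))"
  unfolding ulc_wrt_def
proof (intro conjI allI impI)
  show "(\<Sum>i\<in>UNIV. v i * c (n + e i)) \<ge> 0" for n
    by (intro sum_nonneg mult_nonneg_nonneg v ulc_wrtD[OF c])
  show "(\<Sum>i\<in>UNIV. v i * c (n + e j + e i)) = 0" if "(\<Sum>i\<in>UNIV. v i * c (n + e i)) = 0" for n j
  proof -
    have "v i * c (n + e i) = 0" for i
      using that by (simp add: sum_nonneg_eq_0_iff v ulc_wrtD(1)[OF c])
    then have "v i * c (n + e i + e j) = 0" for i using ulc_wrtD(2)[OF c] by fastforce
    then show ?thesis by (intro sum.neutral) (simp add: add_ac)
  qed
  fix n x
  show "(\<Sum>i\<in>UNIV. v i * c (n + e i)) *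
      (\<Sum>j\<in>UNIV. \<Sum>k\<in>UNIV. x j * x k * (\<Sum>i\<in>UNIV. v i * c (n + e j + e k + e i)))
      \<le> (\<Sum>j\<in>UNIV. x j * (\<Sum>i\<in>UNIV. v i * c (n + e j + e i)))\<^sup>2"
  proof (cases "c n = 0")
    case True
    then show ?thesis using ulc_wrtD(2)[OF c] by simp
  next
    case False
    define E where "E = case_option 0 e"
    have cE: "ulc_wrt E c" unfolding E_def by (rule ulc_wrt_homogenize[OF c])
    have E: "E None = 0" "E (Some i) = e i" for i by (simp_all add: E_def)
    define T where "T p q r = c (n + E p + E q + E r)" for p q r
    \<comment> \<open>Extending \<open>v\<close> and \<open>x\<close> by 0 at \<open>None\<close>
      recovers the inhomogeneous inequality; the direction is then only nonnegative, not
      positive.\<close>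
    have "(\<Sum>p\<in>UNIV. case_option 0 v p * T p None None) *
        (\<Sum>q\<in>UNIV. \<Sum>r\<in>UNIV. case_option 0 x q * case_option 0 x r *
          (\<Sum>p\<in>UNIV. case_option 0 v p * T p q r))
        \<le> (\<Sum>q\<in>UNIV. case_option 0 x q * (\<Sum>p\<in>UNIV. case_option 0 v p * T p None q))\<^sup>2"
    proof (rule Lorentzian_cubic_derivative)
      show "T p q r = T q p r" "T p q r = T p r q" for p q r by (simp_all add: T_def add_ac)
      show "T p q r \<ge> 0" for p q r unfolding T_def by (rule ulc_wrtD[OF cE])
      show "T p None None * (\<Sum>q\<in>UNIV. \<Sum>r\<in>UNIV. y q * y r * T p q r)
          \<le> (\<Sum>q\<in>UNIV. y q * T p None q)\<^sup>2" for p y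
        using ulc_wrtD(3)[OF cE, of "n + E p" y] by (simp add: T_def E)
      show "T None None None > 0"
        using False ulc_wrtD(1)[OF c, of n] by (simp add: T_def E less_le)
      show "T p q r = 0" if "T p None None = 0" for p q r
        using that ulc_wrtD(2)[OF cE] by (simp add: T_def E)
      show "case_option 0 v p \<ge> 0" for p using v by (cases p) auto
    qed
    then show ?thesis by (simp add: sum_UNIV_option T_def E add_ac)
  qed
qed

lemma sum_UNIV_sum:
  fixes f :: "'i::finite + 'j::finite \<Rightarrow> 'b::comm_monoid_add"
  shows "(\<Sum>p\<in>UNIV. f p) = (\<Sum>i\<in>UNIV. f (Inl i)) + (\<Sum>j\<in>UNIV. f (Inr j))"
  by (simp add: UNIV_Plus_UNIV[symmetric] sum.Plus del: UNIV_Plus_UNIV)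

text \<open>The logarithm of a product in disjoint variables has a block diagonal Hessian.
  Concretely, the mixed terms in \<open>la * lb\<close> cancel, and the two given inequalities
  remain, scaled by squares.\<close>

lemma ulc_wrt_product:
  fixes e :: "'i::finite \<Rightarrow> 'm::comm_monoid_add" and e' :: "'j::finite \<Rightarrow> 'n::comm_monoid_add"
  assumes a: "ulc_wrt e a" and b: "ulc_wrt e' b"
  shows "ulc_wrt (case_sum (\<lambda>i. (e i, 0)) (\<lambda>j. (0, e' j))) (\<lambda>(k, l). a k * b l)"
  unfolding ulc_wrt_def
proof (intro conjI allI impI)
  let ?E = "case_sum (\<lambda>i. (e i, 0)) (\<lambda>j. (0, e' j))" and ?c = "\<lambda>(k, l). a k * b l"
  show "?c n \<ge> 0" for n using ulc_wrtD(1)[OF a] ulc_wrtD(1)[OF b] by (cases n) simp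
  show "?c (n + ?E p) = 0" if "?c n = 0" for n p
    using that ulc_wrtD(2)[OF a] ulc_wrtD(2)[OF b] by (cases n; cases p) auto
  fix n :: "'m \<times> 'n" and x :: "'i + 'j \<Rightarrow> real"
  obtain k l where n: "n = (k, l)" by (cases n)
  define la where "la = (\<Sum>i\<in>UNIV. x (Inl i) * a (k + e i))"
  define lb where "lb = (\<Sum>i\<in>UNIV. x (Inr i) * b (l + e' i))"
  define Qa where "Qa = (\<Sum>i\<in>UNIV. \<Sum>j\<in>UNIV. x (Inl i) * x (Inl j) * a (k + e i + e j))"
  define Qb where "Qb = (\<Sum>i\<in>UNIV. \<Sum>j\<in>UNIV. x (Inr i) * x (Inr j) * b (l + e' i + e' j))"
  have 1: "(\<Sum>p\<in>UNIV. \<Sum>q\<in>UNIV. x p * x q * ?c (n + ?E p + ?E q)) = b l * Qa + 2 * la * lb + a k * Qb"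
  proof -
    have "(\<Sum>i\<in>UNIV. \<Sum>j\<in>UNIV. x (Inr i) * x (Inl j) * (a (k + e j) * b (l + e' i))) = la * lb"
      unfolding la_def lb_def sum_product by (subst sum.swap) (simp add: mult_ac)
    then show ?thesis
      by (simp add: n sum_UNIV_sum sum.distrib Qa_def Qb_def sum_distrib_left)
         (simp add: la_def lb_def sum_product mult_ac)
  qed
  have 2: "(\<Sum>p\<in>UNIV. x p * ?c (n + ?E p)) = b l * la + a k * lb"
    by (simp add: n sum_UNIV_sum la_def lb_def sum_distrib_left mult_ac)
  have "a k * Qa \<le> la\<^sup>2" "b l * Qb \<le> lb\<^sup>2"
    unfolding Qa_def Qb_def la_def lb_def by (rule ulc_wrtD[OF a] ulc_wrtD[OF b])+
  then have "(b l)\<^sup>2 * (a k * Qa) \<le> (b l)\<^sup>2 * la\<^sup>2" "(a k)\<^sup>2 * (b l * Qb) \<le> (a k)\<^sup>2 * lb\<^sup>2"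
    by (auto intro: mult_left_mono)
  then show "?c n * (\<Sum>p\<in>UNIV. \<Sum>q\<in>UNIV. x p * x q * ?c (n + ?E p + ?E q))
      \<le> (\<Sum>p\<in>UNIV. x p * ?c (n + ?E p))\<^sup>2"
    unfolding 1 2 by (simp add: n power2_eq_square algebra_simps)
qed


section \<open>Restriction of a power series to the diagonal\<close>

lemma vec_fact_pos: "vec_fact n > 0"
  by (simp add: vec_fact_def)

lemma vec_fact_add_axis: "vec_fact (n + axis i 1) = (n $ i + 1) * vec_fact n"
proof -
  have "vec_fact (n + axis i 1) = fact ((n + axis i 1) $ i) * (\<Prod>j\<in>UNIV - {i}. fact ((n + axis i 1) $ j))"
    unfolding vec_fact_def by (rule prod.remove) auto
  also have "(\<Prod>j\<in>UNIV - {i}. fact ((n + axis i 1) $ j)) = (\<Prod>j\<in>UNIV - {i}. fact (n $ j) :: nat)"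
    by (intro prod.cong) (auto simp: axis_def)
  also have "fact ((n + axis i 1) $ i) = (n $ i + 1) * (fact (n $ i) :: nat)"
    by (simp add: axis_def)
  also have "(n $ i + 1) * (fact (n $ i) :: nat) * (\<Prod>j\<in>UNIV - {i}. fact (n $ j))
      = (n $ i + 1) * vec_fact n"
    unfolding vec_fact_def by (subst prod.remove[of UNIV i "\<lambda>j. fact (n $ j)"]) (simp_all only: mult.assoc finite UNIV_I)
  finally show ?thesis .
qed

text \<open>If \<open>c (k, l)\<close> are the derivatives at 0 of f(x, y), this is the
  \<open>n\<close>-th derivative at 0 of f(z, z); the quotient is a product of binomial
  coefficients.\<close>

definition binomial_diagonal :: "((nat ^ 'd) \<times> (nat ^ 'd) \<Rightarrow> real) \<Rightarrow> nat ^ 'd \<Rightarrow> real" where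
  "binomial_diagonal c n =
     (\<Sum>m\<in>{0..n}. real (vec_fact n) / (real (vec_fact m) * real (vec_fact (n - m))) * c (m, n - m))"

text \<open>
  The Leibniz rule: replacing the variables \<open>x\<close>, \<open>y\<close> of a power series by a single \<open>z\<close> turns
  \<open>\<partial>/\<partial>x + \<partial>/\<partial>y\<close> into \<open>\<partial>/\<partial>z\<close>.
\<close>
lemma binomial_diagonal_add_axis:
  "binomial_diagonal c (n + axis i 1) =
     binomial_diagonal (\<lambda>(k, l). c (k + axis i 1, l) + c (k, l + axis i 1)) n"
proof -
  note One_nat_def [simp del]
  let ?N = "n + axis i 1"
  define g where "g m = real (vec_fact n) / (real (vec_fact m) * real (vec_fact (?N - m))) * c (m, ?N - m)"
    for m
  have ax: "axis i (1::nat) $ j = (if j = i then 1 else 0)" for j by (simp add: axis_def)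
  \<comment> \<open>Pascal's rule: the factor \<open>?N $ i\<close> gained by the factorial splits
    into \<open>m $ i\<close> and \<open>(?N - m) $ i\<close>. In each half the terms with zero
    factor drop out, leaving sums over \<open>{0..n}\<close>, the first one after a shift.\<close>
  have "binomial_diagonal c ?N = (\<Sum>m\<in>{0..?N}. real (m $ i) * g m + real ((?N - m) $ i) * g m)"
    unfolding binomial_diagonal_def
  proof (intro sum.cong refl)
    fix m assume "m \<in> {0..?N}"
    then have "m $ i \<le> ?N $ i" unfolding atLeastAtMost_iff less_eq_vec_def by blast
    then have Ni: "real (?N $ i) = real (m $ i) + real ((?N - m) $ i)" by simp
    have Nf: "real (vec_fact ?N) = real (?N $ i) * real (vec_fact n)"
      by (simp add: vec_fact_add_axis ax)
    show "real (vec_fact ?N) / (real (vec_fact m) * real (vec_fact (?N - m))) * c (m, ?N - m)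
        = real (m $ i) * g m + real ((?N - m) $ i) * g m"
      unfolding distrib_right[symmetric] Ni[symmetric] Nf g_def
      by (simp only: times_divide_eq_left times_divide_eq_right mult.assoc)
  qed
  also have "\<dots> = (\<Sum>m\<in>{0..?N}. real (m $ i) * g m) + (\<Sum>m\<in>{0..?N}. real ((?N - m) $ i) * g m)"
    by (rule sum.distrib)
  also have "(\<Sum>m\<in>{0..?N}. real (m $ i) * g m)
      = (\<Sum>m\<in>(\<lambda>m. m + axis i 1) ` {0..n}. real (m $ i) * g m)"
  proof (intro sum.mono_neutral_right ballI)
    show "(\<lambda>m. m + axis i 1) ` {0..n} \<subseteq> {0..?N}" by (auto simp: less_eq_vec_def)
    fix m assume m: "m \<in> {0..?N} - (\<lambda>m. m + axis i 1) ` {0..n}"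
    show "real (m $ i) * g m = 0"
    proof (rule ccontr)
      assume "real (m $ i) * g m \<noteq> 0"
      then have "m $ i > 0" by auto
      then have "m = (m - axis i 1) + axis i 1" by (auto simp: vec_eq_iff ax)
      moreover have le: "m $ j \<le> n $ j + (if j = i then 1 else 0)" for j
        using m by (auto simp: less_eq_vec_def ax)
      have "(m - axis i 1) $ j \<le> n $ j" for j using le[of j] by (simp add: ax split: if_splits)
      then have "m - axis i 1 \<in> {0..n}" by (simp add: less_eq_vec_def)
      ultimately show False using m by blast
    qed
  qed (rule finite_atMost_vec)
  also have "\<dots> = (\<Sum>m\<in>{0..n}. real ((m + axis i 1) $ i) * g (m + axis i 1))"
    by (subst sum.reindex) (auto simp: inj_on_def)
  also have "\<dots> = (\<Sum>m\<in>{0..n}. real (vec_fact n) / (real (vec_fact m) * real (vec_fact (n - m)))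
      * c (m + axis i 1, n - m))"
  proof (intro sum.cong refl)
    fix m assume "m \<in> {0..n}"
    have "?N - (m + axis i 1) = n - m" by (simp add: vec_eq_iff)
    moreover have "real (vec_fact (m + axis i 1)) = real ((m + axis i 1) $ i) * real (vec_fact m)"
      by (simp add: vec_fact_add_axis ax)
    moreover have "real ((m + axis i 1) $ i) \<noteq> 0" by (simp add: ax)
    ultimately show "real ((m + axis i 1) $ i) * g (m + axis i 1)
        = real (vec_fact n) / (real (vec_fact m) * real (vec_fact (n - m))) * c (m + axis i 1, n - m)"
      by (simp add: g_def)
  qed
  also have "(\<Sum>m\<in>{0..?N}. real ((?N - m) $ i) * g m) = (\<Sum>m\<in>{0..n}. real ((?N - m) $ i) * g m)"
  proof (intro sum.mono_neutral_right ballI)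
    show "{0..n} \<subseteq> {0..?N}" by (auto simp: less_eq_vec_def intro: trans_le_add1)
    fix m assume m: "m \<in> {0..?N} - {0..n}"
    show "real ((?N - m) $ i) * g m = 0"
    proof (rule ccontr)
      assume "real ((?N - m) $ i) * g m \<noteq> 0"
      then have "(?N - m) $ i > 0" by (metis gr0I mult_zero_left of_nat_0)
      then have "m $ i \<le> n $ i" by (simp add: ax)
      moreover have "m $ j \<le> n $ j + (if j = i then 1 else 0)" for j
        using m by (auto simp: less_eq_vec_def ax)
      ultimately have "m $ j \<le> n $ j" for j by (metis add.right_neutral)
      then show False using m by (simp add: less_eq_vec_def)
    qed
  qed (rule finite_atMost_vec)
  also have "\<dots> = (\<Sum>m\<in>{0..n}. real (vec_fact n) / (real (vec_fact m) * real (vec_fact (n - m)))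
      * c (m, n - m + axis i 1))"
  proof (intro sum.cong refl)
    fix m assume "m \<in> {0..n}"
    then have N: "?N - m = n - m + axis i 1" by (simp add: less_eq_vec_def vec_eq_iff)
    moreover have "real (vec_fact (n - m + axis i 1))
        = real ((n - m + axis i 1) $ i) * real (vec_fact (n - m))"
      by (simp add: vec_fact_add_axis ax)
    moreover have "real ((n - m + axis i 1) $ i) \<noteq> 0" by (simp add: ax)
    ultimately show "real ((?N - m) $ i) * g m
        = real (vec_fact n) / (real (vec_fact m) * real (vec_fact (n - m))) * c (m, n - m + axis i 1)"
      unfolding g_def N by simp
  qed
  finally show ?thesis
    by (simp add: binomial_diagonal_def sum.distrib distrib_left)
qed

text \<open>Induction on the total degree of \<open>n\<close>: each unit of \<open>n\<close> is
  absorbed into \<open>c\<close> as a derivative along a diagonal direction, which preserves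
  \<open>ulc_wrt\<close>. At degree 0 only the hypothesis at the origin is left.\<close>

lemma binomial_diagonal_log_concave:
  fixes c :: "(nat ^ 'd) \<times> (nat ^ 'd) \<Rightarrow> real"
  assumes "ulc_wrt (case_sum (\<lambda>i. (axis i 1, 0)) (\<lambda>i. (0, axis i 1))) c"
  shows "binomial_diagonal c n *
      (\<Sum>i\<in>UNIV. \<Sum>j\<in>UNIV. x i * x j * binomial_diagonal c (n + axis i 1 + axis j 1))
      \<le> (\<Sum>i\<in>UNIV. x i * binomial_diagonal c (n + axis i 1))\<^sup>2"
  using assms
proof (induction "\<Sum>i\<in>UNIV. n $ i" arbitrary: n c rule: less_induct)
  case less
  let ?e = "case_sum (\<lambda>i. (axis i 1, 0)) (\<lambda>i. (0, axis i 1)) :: 'd + 'd \<Rightarrow> (nat ^ 'd) \<times> (nat ^ 'd)"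
  show ?case
  proof (cases "n = 0")
    case True
    have d0: "binomial_diagonal c' 0 = c' (0, 0)" for c' :: "(nat ^ 'd) \<times> (nat ^ 'd) \<Rightarrow> real"
      using vec_fact_pos[of "0 :: nat ^ 'd"]
      by (simp add: binomial_diagonal_def vec_fact_def)
    \<comment> \<open>Differentiating f(z, z) along \<open>x\<close> differentiates f along
      \<open>x\<close> in both blocks.\<close>
    define X where "X = case_sum x x"
    have "(\<Sum>i\<in>UNIV. x i * binomial_diagonal c (n + axis i 1)) = (\<Sum>p\<in>UNIV. X p * c (0 + ?e p))"
      by (simp add: True binomial_diagonal_add_axis[of _ 0, unfolded add_0_left] d0 sum_UNIV_sum
          X_def sum.distrib[symmetric] distrib_left zero_prod_def del: One_nat_def)
    moreover have "(\<Sum>i\<in>UNIV. \<Sum>j\<in>UNIV. x i * x j * binomial_diagonal c (n + axis i 1 + axis j 1))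
        = (\<Sum>p\<in>UNIV. \<Sum>q\<in>UNIV. X p * X q * c (0 + ?e p + ?e q))"
      by (simp add: True binomial_diagonal_add_axis[of _ "axis _ 1"]
          binomial_diagonal_add_axis[of _ 0, unfolded add_0_left] d0 sum_UNIV_sum X_def sum.distrib distrib_left zero_prod_def add_ac
          del: One_nat_def)
    moreover have "binomial_diagonal c n = c 0" by (simp add: True d0 zero_prod_def)
    ultimately show ?thesis using ulc_wrtD(3)[OF less.prems, of 0 X] by simp
  next
    case False
    then obtain i where i: "n $ i > 0" by (auto simp: vec_eq_iff)
    define n' where "n' = n - axis i 1"
    have n: "n = n' + axis i 1" using i by (auto simp: n'_def vec_eq_iff axis_def)
    define c' where "c' = (\<lambda>(k, l). c (k + axis i 1, l) + c (k, l + axis i 1))"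
    have "c' = (\<lambda>m. \<Sum>p\<in>UNIV. case_sum (\<lambda>j. of_bool (j = i)) (\<lambda>j. of_bool (j = i)) p * c (m + ?e p))"
      by (auto simp: c'_def sum_UNIV_sum fun_eq_iff)
    then have "ulc_wrt ?e c'"
      using ulc_wrt_directional_derivative[OF less.prems] by (simp add: sum.case_eq_if split: sum.split)
    moreover have "(\<Sum>j\<in>UNIV. n' $ j) < (\<Sum>j\<in>UNIV. n $ j)"
      by (intro sum_strict_mono_ex1) (auto simp: n axis_def)
    ultimately have "binomial_diagonal c' n' *
      (\<Sum>i\<in>UNIV. \<Sum>j\<in>UNIV. x i * x j * binomial_diagonal c' (n' + axis i 1 + axis j 1))
      \<le> (\<Sum>i\<in>UNIV. x i * binomial_diagonal c' (n' + axis i 1))\<^sup>2"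
      using less.hyps by blast
    moreover have shift: "binomial_diagonal c (m + axis i 1) = binomial_diagonal c' m" for m
      unfolding c'_def by (rule binomial_diagonal_add_axis)
    moreover have "n + axis j 1 = n' + axis j 1 + axis i 1" for j
      by (simp add: n add_ac)
    moreover have "n + axis j 1 + axis k 1 = n' + axis j 1 + axis k 1 + axis i 1" for j k
      by (simp add: n add_ac)
    moreover have "binomial_diagonal c n = binomial_diagonal c' n'"
      by (simp only: n shift)
    ultimately show ?thesis by (simp only:)
  qed
qed

section \<open>From matrices and measures to coefficient inequalities\<close>

text \<open>Congruence by the diagonal matrix of \<open>l\<close> turns the entries into
  \<open>l i * l j - a * q i j\<close>. These vanish as soon as one index lies outside
  \<open>I\<close>, so the sums extend to all indices.\<close>

lemma psd_on_iff_reversed_Cauchy_Schwarz: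
  fixes l :: "'i::finite \<Rightarrow> real"
  assumes l: "\<And>i. l i \<noteq> 0 \<longleftrightarrow> i \<in> I" and q: "\<And>i j. i \<notin> I \<Longrightarrow> q i j = 0"
    and sym: "\<And>i j. q i j = q j i"
  shows "psd_on I (\<lambda>i j. 1 - a * q i j / (l i * l j)) \<longleftrightarrow>
    (\<forall>x. a * (\<Sum>i\<in>UNIV. \<Sum>j\<in>UNIV. x i * x j * q i j) \<le> (\<Sum>i\<in>UNIV. x i * l i)\<^sup>2)"
    (is "psd_on I ?M \<longleftrightarrow> ?R")
proof -
  have eq: "(\<Sum>i\<in>I. \<Sum>j\<in>I. y i * ?M i j * y j)
      = (\<Sum>i\<in>UNIV. x i * l i)\<^sup>2 - a * (\<Sum>i\<in>UNIV. \<Sum>j\<in>UNIV. x i * x j * q i j)"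
    if y: "\<And>i. i \<in> I \<Longrightarrow> y i = x i * l i" for x y
  proof -
    have q': "q i j = 0" if "j \<notin> I" for i j using q[OF that] sym by simp
    have "(\<Sum>i\<in>I. \<Sum>j\<in>I. y i * ?M i j * y j)
        = (\<Sum>i\<in>I. \<Sum>j\<in>I. (x i * l i) * (x j * l j) - a * (x i * x j * q i j))"
      by (intro sum.cong refl) (auto simp: y l[symmetric] field_simps)
    also have "\<dots> = (\<Sum>i\<in>I. x i * l i)\<^sup>2 - a * (\<Sum>i\<in>I. \<Sum>j\<in>I. x i * x j * q i j)"
      unfolding power2_eq_square sum_product unfolding sum_distrib_left by (simp only: sum_subtractf)
    also have "(\<Sum>i\<in>I. x i * l i) = (\<Sum>i\<in>UNIV. x i * l i)"
      using l by (intro sum.mono_neutral_left) auto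
    also have "(\<Sum>i\<in>I. \<Sum>j\<in>I. x i * x j * q i j) = (\<Sum>i\<in>I. \<Sum>j\<in>UNIV. x i * x j * q i j)"
      using q' by (intro sum.cong sum.mono_neutral_left refl) auto
    also have "\<dots> = (\<Sum>i\<in>UNIV. \<Sum>j\<in>UNIV. x i * x j * q i j)"
      using q by (intro sum.mono_neutral_left) auto
    finally show ?thesis .
  qed
  show ?thesis
  proof
    assume psd: "psd_on I ?M"
    show ?R
    proof
      fix x
      have "0 \<le> (\<Sum>i\<in>I. \<Sum>j\<in>I. (x i * l i) * ?M i j * (x j * l j))"
        using psd[unfolded psd_on_def, THEN conjunct2, rule_format, of "\<lambda>i. x i * l i"] .
      then show "a * (\<Sum>i\<in>UNIV. \<Sum>j\<in>UNIV. x i * x j * q i j) \<le> (\<Sum>i\<in>UNIV. x i * l i)\<^sup>2"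
        by (subst (asm) eq[of _ x]) auto
    qed
  next
    assume R: ?R
    show "psd_on I ?M" unfolding psd_on_def
    proof (intro conjI allI ballI)
      show "?M i j = ?M j i" for i j by (simp add: sym mult_ac)
      fix y :: "'i \<Rightarrow> real"
      have "(\<Sum>i\<in>I. \<Sum>j\<in>I. y i * ?M i j * y j) = (\<Sum>i\<in>UNIV. y i / l i * l i)\<^sup>2
          - a * (\<Sum>i\<in>UNIV. \<Sum>j\<in>UNIV. (y i / l i) * (y j / l j) * q i j)"
        using l by (intro eq[of y "\<lambda>i. y i / l i"]) simp
      then show "0 \<le> (\<Sum>i\<in>I. \<Sum>j\<in>I. y i * ?M i j * y j)"
        using R[rule_format, of "\<lambda>i. y i / l i"] by linarith
    qed
  qed
qed

lemma weight_eq_0_iff: "weight \<mu> n = 0 \<longleftrightarrow> n \<notin> set_pmf \<mu>"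
  using vec_fact_pos[of n] by (simp add: weight_def set_pmf_iff)

lemma ULC_iff_ulc_wrt:
  fixes \<mu> :: "(nat ^ 'd) pmf"
  assumes dc: "downward_closed (set_pmf \<mu>)"
  shows "ULC \<mu> \<longleftrightarrow> ulc_wrt (\<lambda>i. axis i 1) (weight \<mu>)"
proof -
  let ?CS = "\<lambda>n x. weight \<mu> n * (\<Sum>i\<in>UNIV. \<Sum>j\<in>UNIV. x i * x j * weight \<mu> (n + axis i 1 + axis j 1))
      \<le> (\<Sum>i\<in>UNIV. x i * weight \<mu> (n + axis i 1))\<^sup>2"
  have nonneg: "weight \<mu> n \<ge> 0" for n by (simp add: weight_def)
  have closed: "weight \<mu> (n + axis i 1) = 0" if "weight \<mu> n = 0" for n i
    using dc that unfolding downward_closed_def weight_eq_0_iff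
    by (metis less_eq_vec_def le_add1 vector_add_component)
  have "psd_on (up_indices \<mu> n) (\<lambda>i j. 1 - weight \<mu> n * weight \<mu> (n + axis i 1 + axis j 1) /
                   (weight \<mu> (n + axis i 1) * weight \<mu> (n + axis j 1))) \<longleftrightarrow> (\<forall>x. ?CS n x)" for n
  proof (rule psd_on_iff_reversed_Cauchy_Schwarz)
    show "(weight \<mu> (n + axis i 1) \<noteq> 0) = (i \<in> up_indices \<mu> n)" for i
      by (simp add: weight_eq_0_iff up_indices_def)
    then show "weight \<mu> (n + axis i 1 + axis j 1) = 0" if "i \<notin> up_indices \<mu> n" for i j
      using that closed by blast
    show "weight \<mu> (n + axis i 1 + axis j 1) = weight \<mu> (n + axis j 1 + axis i 1)" for i j
      by (simp add: add_ac)
  qed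
  then have "ULC \<mu> \<longleftrightarrow> (\<forall>n\<in>set_pmf \<mu>. \<forall>x. ?CS n x)"
    using dc unfolding ULC_def by simp
  also have "\<dots> \<longleftrightarrow> (\<forall>n x. ?CS n x)"
  proof -
    \<comment> \<open>Off the support the left-hand side is 0, so quantifying over all
      \<open>n\<close> adds nothing.\<close>
    have "?CS n x" if "n \<notin> set_pmf \<mu>" for n x using that by (simp add: weight_eq_0_iff[symmetric])
    then show ?thesis by blast
  qed
  finally show ?thesis unfolding ulc_wrt_def using nonneg closed by blast
qed

lemma weight_conv_pmf:
  "weight (conv_pmf \<mu> \<nu>) n = binomial_diagonal (\<lambda>(k, l). weight \<mu> k * weight \<nu> l) n"
  unfolding weight_def pmf_conv_pmf binomial_diagonal_def sum_distrib_left
  by (intro sum.cong refl) (simp add: vec_fact_pos less_imp_neq[THEN not_sym])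

lemma downward_closed_conv_pmf:
  fixes \<mu> \<nu> :: "(nat ^ 'd) pmf"
  assumes \<mu>: "downward_closed (set_pmf \<mu>)" and \<nu>: "downward_closed (set_pmf \<nu>)"
  shows "downward_closed (set_pmf (conv_pmf \<mu> \<nu>))"
  unfolding downward_closed_def
proof (intro ballI allI impI)
  fix n m assume "n \<in> set_pmf (conv_pmf \<mu> \<nu>)" and m: "m \<le> n"
  then obtain k l where k: "k \<in> set_pmf \<mu>" and l: "l \<in> set_pmf \<nu>" and n: "n = k + l"
    by (auto simp: conv_pmf_altdef)
  \<comment> \<open>Greedy splitting: as much of \<open>m\<close> as possible is taken from
    \<open>k\<close>, and the remainder fits below \<open>l\<close>.\<close>
  define k' where "k' = (\<chi> i. min (m $ i) (k $ i))"
  have "k' \<le> k" by (simp add: k'_def less_eq_vec_def)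
  then have "k' \<in> set_pmf \<mu>" using \<mu> k unfolding downward_closed_def by blast
  moreover have "m - k' \<le> l" unfolding less_eq_vec_def
  proof
    fix i
    show "(m - k') $ i \<le> l $ i"
      using m[unfolded n less_eq_vec_def, rule_format, of i] by (simp add: k'_def)
  qed
  then have "m - k' \<in> set_pmf \<nu>" using \<nu> l unfolding downward_closed_def by blast
  moreover have "m = k' + (m - k')" by (simp add: k'_def vec_eq_iff)
  ultimately show "m \<in> set_pmf (conv_pmf \<mu> \<nu>)"
    by (force simp: conv_pmf_altdef image_iff)
qed

theorem theoremE9:
  fixes \<mu> \<nu> :: "(nat ^ 'd) pmf"
  assumes "ULC \<mu>" and "ULC \<nu>"
  shows "ULC (conv_pmf \<mu> \<nu>)"
proof -
  let ?\<rho> = "conv_pmf \<mu> \<nu>"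
  have dc: "downward_closed (set_pmf \<mu>)" "downward_closed (set_pmf \<nu>)"
    using assms by (auto simp: ULC_def)
  then have dc_conv: "downward_closed (set_pmf ?\<rho>)" by (rule downward_closed_conv_pmf)
  have "ulc_wrt (case_sum (\<lambda>i. (axis i 1, 0)) (\<lambda>i. (0, axis i 1))) (\<lambda>(k, l). weight \<mu> k * weight \<nu> l)"
    using assms dc by (intro ulc_wrt_product) (simp_all add: ULC_iff_ulc_wrt)
  from binomial_diagonal_log_concave[OF this]
  have CS: "weight ?\<rho> n * (\<Sum>i\<in>UNIV. \<Sum>j\<in>UNIV. x i * x j * weight ?\<rho> (n + axis i 1 + axis j 1))
      \<le> (\<Sum>i\<in>UNIV. x i * weight ?\<rho> (n + axis i 1))\<^sup>2" for n x
    by (simp add: weight_conv_pmf)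
  have "n + axis i 1 \<notin> set_pmf ?\<rho>" if "n \<notin> set_pmf ?\<rho>" for n i
    using dc_conv that unfolding downward_closed_def
    by (metis less_eq_vec_def le_add1 vector_add_component)
  then have "ulc_wrt (\<lambda>i. axis i 1) (weight ?\<rho>)"
    using CS unfolding ulc_wrt_def weight_eq_0_iff by (simp add: weight_def)
  then show ?thesis using ULC_iff_ulc_wrt[OF dc_conv] by blast
qed

end
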